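(* For every $n\ge 0$, $$\sum_{\sigma\in S_n(3\textrm{-}1\textrm{-}2)}x^{occ_{321}(\sigma)}y^{occ_{132}(\sigma)}z^{occ_{213}(\sigma)}=\sum_{\sigma\in S_n(3\textrm{-}1\textrm{-}2)}x^{occ_{123}(\sigma)}y^{occ_{231}(\sigma)}z^{occ_{213}(\sigma)}$$ and $$\sum_{\sigma\in S_n(3\textrm{-}1\textrm{-}2)}x^{occ_{321}(\sigma)}y^{occ_{231}(\sigma)}z^{occ_{213}(\sigma)}=\sum_{\sigma\in S_n(3\textrm{-}1\textrm{-}2)}x^{occ_{123}(\sigma)}y^{occ_{132}(\sigma)}z^{occ_{213}(\sigma)}.$$
   Context: $S_n(3\textrm{-}1\textrm{-}2)$ is the set of $\sigma\in S_n$ with no indices $i<j<l$ such that $\sigma(j)<\sigma(l)<\sigma(i)$. For $\tau\in S_3$, $occ_{\tau}(\sigma)$ is the number of indices $i$, $1\le i\le n-2$, such that $\sigma(i)\sigma(i+1)\sigma(i+2)$ is order-isomorphic to $\tau$ (occurrences of the consecutive pattern $\tau$). *)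

theory Defs
  imports "HOL-Combinatorics.Permutations"
begin

definition S_312 :: "nat \<Rightarrow> (nat \<Rightarrow> nat) set" where
  "S_312 n = {\<sigma>. \<sigma> permutes {1..n} \<and>
     \<not> (\<exists>i j l. 1 \<le> i \<and> i < j \<and> j < l \<and> l \<le> n \<and> \<sigma> j < \<sigma> l \<and> \<sigma> l < \<sigma> i)}"

text \<open>The pattern \<open>\<tau>\<close> of length three is a list in one-line notation, e.g. \<open>[3,2,1]\<close>.
  List positions count from 0, arguments of \<open>\<sigma>\<close> from 1.
  The condition on \<open>i\<close> is \<open>1 \<le> i \<le> n - 2\<close>, written without truncated subtraction.\<close>

definition occ :: "nat list \<Rightarrow> nat \<Rightarrow> (nat \<Rightarrow> nat) \<Rightarrow> nat" where
  "occ \<tau> n \<sigma> = card {i. 1 \<le> i \<and> i + 2 \<le> n \<and>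
     (\<forall>a<3. \<forall>b<3. \<sigma> (i + a) < \<sigma> (i + b) \<longleftrightarrow> \<tau> ! a < \<tau> ! b)}"

end

theory Submission
  imports Defs "HOL-Library.Tree"
begin

text \<open>
  A 312-avoiding word with minimum \<open>k\<close> has the form \<open>A k B\<close> with every letter of \<open>A\<close> below every
  letter of \<open>B\<close>, so 312-avoiding permutations correspond to binary trees: the letters are read in
  inorder and valued by preorder rank. An occurrence of a consecutive pattern is then visible at its
  middle node: 213 at a node with two children, 321 (123) at a node with only a left (right) child
  which is not the last (first) one in inorder, and 132 (231) at a leaf which is a left (right)
  child and not the first (last) node. Hence mirroring the tree exchanges 321 with 123 and 132 with
  231, and preserves 213; this proves both identities at once.
\<close>

section \<open>Consecutive triples in lists\<close>

fun triples :: "('a \<Rightarrow> 'a \<Rightarrow> 'a \<Rightarrow> bool) \<Rightarrow> 'a list \<Rightarrow> nat" where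
  "triples P (a # b # c # xs) = of_bool (P a b c) + triples P (b # c # xs)"
| "triples P xs = 0"

text \<open>When a word is cut at a letter, the windows having that letter at one end see only the
  last two letters before it or the first two after it.\<close>

definition starts :: "('a \<Rightarrow> 'a \<Rightarrow> bool) \<Rightarrow> 'a list \<Rightarrow> bool" where
  "starts R xs \<longleftrightarrow> (\<exists>a b ys. xs = a # b # ys \<and> R a b)"

definition ends :: "('a \<Rightarrow> 'a \<Rightarrow> bool) \<Rightarrow> 'a list \<Rightarrow> bool" where
  "ends R xs \<longleftrightarrow> (\<exists>ys a b. xs = ys @ [a, b] \<and> R a b)"

lemma starts_simps [simp]:
  "\<not> starts R []" "\<not> starts R [a]" "starts R (a # b # xs) \<longleftrightarrow> R a b"
  by (auto simp: starts_def)

lemma ends_simps [simp]: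
  "\<not> ends R []" "\<not> ends R [a]" "ends R (xs @ [a, b]) \<longleftrightarrow> R a b"
  by (auto simp: ends_def)

text \<open>A window of three letters either ends no later than \<open>b\<close> or starts no
  earlier than \<open>a\<close>, never both; an overlap of exactly two letters therefore counts each
  window once.\<close>

lemma triples_append_overlap:
  "triples P (xs @ a # b # ys) = triples P (xs @ [a, b]) + triples P (a # b # ys)"
proof (induction xs)
  case (Cons x xs)
  then show ?case by (cases xs; cases "tl xs") auto
qed simp

lemma triples_snoc: "triples P (xs @ [k]) = triples P xs + of_bool (ends (\<lambda>a b. P a b k) xs)"
proof (cases xs rule: rev_cases)
  case (snoc ys b)
  show ?thesis
  proof (cases ys rule: rev_cases)
    case inner: (snoc zs a)
    show ?thesis
      using triples_append_overlap[of P zs a b "[k]"] snoc inner by simp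
  qed (simp add: snoc)
qed simp

lemma triples_Cons: "triples P (k # xs) = triples P xs + of_bool (starts (P k) xs)"
  by (cases xs; cases "tl xs") auto

text \<open>Windows missing \<open>k\<close> lie inside \<open>xs\<close> or \<open>ys\<close>; the
  three \<open>of_bool\<close> terms are the windows with \<open>k\<close> as last, first and middle
  letter.\<close>

lemma triples_split:
  "triples P (xs @ k # ys) = triples P xs + triples P ys
     + of_bool (ends (\<lambda>a b. P a b k) xs) + of_bool (starts (P k) ys)
     + of_bool (xs \<noteq> [] \<and> ys \<noteq> [] \<and> P (last xs) k (hd ys))"
proof (cases ys)
  case Nil
  then show ?thesis by (simp add: triples_snoc)
next
  case (Cons y zs)
  have "triples P (xs @ k # y # zs) = triples P (xs @ [k, y]) + triples P (k # y # zs)"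
    by (rule triples_append_overlap)
  moreover have "triples P (xs @ [k, y]) = triples P (xs @ [k]) + of_bool (ends (\<lambda>a b. P a b y) (xs @ [k]))"
    using triples_snoc[of P "xs @ [k]" y] by simp
  moreover have "ends (\<lambda>a b. P a b y) (xs @ [k]) \<longleftrightarrow> xs \<noteq> [] \<and> P (last xs) k y"
    by (cases xs rule: rev_cases) auto
  ultimately show ?thesis
    using Cons triples_snoc[of P xs k] triples_Cons[of P k ys] by simp
qed

lemma triples_conv_card:
  "triples P xs = card {i. i + 2 < length xs \<and> P (xs ! i) (xs ! (i + 1)) (xs ! (i + 2))}"
proof (induction P xs rule: triples.induct)
  case (1 P a b c xs)
  let ?I = "\<lambda>xs. {i. i + 2 < length xs \<and> P (xs ! i) (xs ! (i + 1)) (xs ! (i + 2))}"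
  have "?I (a # b # c # xs) = {i. i = 0 \<and> P a b c} \<union> Suc ` ?I (b # c # xs)"
  proof (rule set_eqI)
    fix i show "i \<in> ?I (a # b # c # xs) \<longleftrightarrow> i \<in> {i. i = 0 \<and> P a b c} \<union> Suc ` ?I (b # c # xs)"
      by (cases i) (auto simp: image_iff)
  qed
  moreover have "finite (?I (b # c # xs))"
    by (rule finite_subset[of _ "{..<length (b # c # xs)}"]) auto
  ultimately have "card (?I (a # b # c # xs))
      = card {i::nat. i = 0 \<and> P a b c} + card (Suc ` ?I (b # c # xs))"
    by (simp only:, intro card_Un_disjoint) auto
  also have "\<dots> = of_bool (P a b c) + card (?I (b # c # xs))"
    by (simp add: card_image)
  finally show ?case using 1 by simp
qed auto

section \<open>Avoidance of 312\<close>

text \<open>\<open>sorted_wrt\<close> compares all pairs of positions, not only adjacent ones, so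
  the clause for \<open>x\<close> excludes every pattern in which \<open>x\<close> plays the
  3.\<close>

fun avoids_312 :: "nat list \<Rightarrow> bool" where
  "avoids_312 [] \<longleftrightarrow> True"
| "avoids_312 (x # xs) \<longleftrightarrow> sorted_wrt (\<lambda>b c. \<not> (b < c \<and> c < x)) xs \<and> avoids_312 xs"

lemma avoids_312_iff_nth:
  "avoids_312 xs \<longleftrightarrow> \<not> (\<exists>i j l. i < j \<and> j < l \<and> l < length xs \<and> xs ! j < xs ! l \<and> xs ! l < xs ! i)"
proof (induction xs)
  case (Cons x xs)
  have "(\<exists>i j l. i < j \<and> j < l \<and> l < length (x # xs) \<and> (x # xs) ! j < (x # xs) ! l \<and> (x # xs) ! l < (x # xs) ! i)
    \<longleftrightarrow> (\<exists>j l. j < l \<and> l < length xs \<and> xs ! j < xs ! l \<and> xs ! l < x) \<or>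
      (\<exists>i j l. i < j \<and> j < l \<and> l < length xs \<and> xs ! j < xs ! l \<and> xs ! l < xs ! i)" (is "?L \<longleftrightarrow> ?R1 \<or> ?R2")
  proof
    assume ?L
    then obtain i j l where *: "i < j" "j < l" "l < length (x # xs)"
      "(x # xs) ! j < (x # xs) ! l" "(x # xs) ! l < (x # xs) ! i" by blast
    then obtain j' l' where "j = Suc j'" "l = Suc l'" by (cases j; cases l) auto
    with * show "?R1 \<or> ?R2" by (cases i) auto
  next
    assume "?R1 \<or> ?R2"
    then show ?L
    proof
      assume ?R1
      then obtain j l where "j < l" "l < length xs" "xs ! j < xs ! l" "xs ! l < x" by blast
      then show ?L by (intro exI[of _ 0] exI[of _ "Suc j"] exI[of _ "Suc l"]) auto
    next
      assume ?R2
      then obtain i j l where "i < j" "j < l" "l < length xs" "xs ! j < xs ! l" "xs ! l < xs ! i" by blast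
      then show ?L by (intro exI[of _ "Suc i"] exI[of _ "Suc j"] exI[of _ "Suc l"]) auto
    qed
  qed
  then show ?case using Cons by (auto simp: sorted_wrt_iff_nth_less)
qed simp

lemma sorted_wrt_if_all_ge:
  "\<forall>c\<in>set xs. x \<le> c \<Longrightarrow> sorted_wrt (\<lambda>b c. \<not> (b < c \<and> c < x)) xs" for x :: "'a::linorder"
  by (induction xs) auto

text \<open>Letters of \<open>ys\<close> are too large to be the 1 or 2 below a 3 taken from
  \<open>xs\<close> or \<open>k\<close>, and \<open>k\<close> cannot be the 2 after a letter of
  \<open>xs\<close>, as those exceed \<open>k\<close>. So a pattern would lie entirely in
  \<open>xs\<close> or in \<open>ys\<close>.\<close>

lemma avoids_312_splitI:
  assumes "avoids_312 xs" "avoids_312 ys" "\<forall>a\<in>set xs. k < a" "\<forall>a\<in>set xs. \<forall>b\<in>set ys. a < b"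
    "\<forall>b\<in>set ys. k < b"
  shows "avoids_312 (xs @ k # ys)"
  using assms
proof (induction xs)
  case Nil
  then have "sorted_wrt (\<lambda>b c. \<not> (b < c \<and> c < k)) ys"
    by (intro sorted_wrt_if_all_ge) auto
  with Nil show ?case by simp
next
  case (Cons x xs)
  then have "sorted_wrt (\<lambda>b c. \<not> (b < c \<and> c < x)) ys"
    by (intro sorted_wrt_if_all_ge) auto
  with Cons show ?case by (auto simp: sorted_wrt_append)
qed

text \<open>The third part lets \<open>k\<close> play the 1. In a distinct word with minimum
  \<open>k\<close> it puts every letter before \<open>k\<close> below every letter after it.\<close>

lemma avoids_312_splitD:
  assumes "avoids_312 (xs @ k # ys)"
  shows "avoids_312 xs" "avoids_312 ys" "\<forall>a\<in>set xs. \<forall>b\<in>set ys. \<not> (k < b \<and> b < a)"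
  using assms by (induction xs) (auto simp: sorted_wrt_append)

section \<open>Binary trees and 312-avoiding words\<close>

text \<open>Node labels are \<open>unit\<close> because the shape alone determines the word. The
  offset \<open>k\<close> hands the two subtrees consecutive blocks of values above the root's
  value.\<close>

fun word :: "nat \<Rightarrow> unit tree \<Rightarrow> nat list" where
  "word k \<langle>\<rangle> = []"
| "word k \<langle>l, u, r\<rangle> = word (k + 1) l @ k # word (k + 1 + size l) r"

lemma length_word [simp]: "length (word k t) = size t"
  by (induction k t rule: word.induct) auto

lemma word_eq_Nil_iff [simp]: "word k t = [] \<longleftrightarrow> t = \<langle>\<rangle>"
  by (cases t) auto

lemma set_word [simp]: "set (word k t) = {k..<k + size t}"
  by (induction k t rule: word.induct) auto

lemma avoids_312_word: "avoids_312 (word k t)"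
  by (induction k t rule: word.induct) (auto intro!: avoids_312_splitI)

text \<open>All values in the subtrees exceed \<open>k\<close>, so the unique occurrence of
  \<open>k\<close> marks where the left word ends and the right one begins.\<close>

lemma word_inject: "word k s = word k t \<Longrightarrow> s = t"
proof (induction k s arbitrary: t rule: word.induct)
  case (2 k l u r)
  then obtain l' r' where t: "t = \<langle>l', (), r'\<rangle>" by (cases t) auto
  have "word (k + 1) l @ k # word (k + 1 + size l) r = word (k + 1) l' @ k # word (k + 1 + size l') r'"
    using "2.prems" t by simp
  then have "word (k + 1) l = word (k + 1) l' \<and> word (k + 1 + size l) r = word (k + 1 + size l') r'"
    by (subst (asm) append_Cons_eq_iff) auto
  \<comment> \<open>The left subtrees must be identified first: the offset of the right word depends
    on \<open>size l\<close>.\<close>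
  moreover from this have "l = l'" using "2.IH"(1) by blast
  ultimately show ?case using "2.IH"(2) t by simp
qed (metis word_eq_Nil_iff)

text \<open>Lying below \<open>B\<close>, the set \<open>A\<close> is an initial segment of the
  interval, and its cardinality then fixes the cut point.\<close>

lemma split_interval:
  fixes a b :: nat
  assumes "A \<union> B = {a..<b}" "\<forall>x\<in>A. \<forall>y\<in>B. x < y" "finite A"
  shows "A = {a..<a + card A}" "B = {a + card A..<b}"
proof -
  have down: "x \<in> A" if "x \<le> y" "y \<in> A" "a \<le> x" for x y
  proof (rule ccontr)
    assume "x \<notin> A"
    moreover have "y \<in> {a..<b}" using assms(1) that by blast
    then have "x \<in> A \<union> B" unfolding assms(1) using that by simp
    ultimately have "x \<in> B" by simp
    then have "y < x" using assms(2) that by blast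
    then show False using that by simp
  qed
  have "A = {a..<a + card A}"
  proof (cases "A = {}")
    case False
    let ?m = "Max A"
    have m: "?m \<in> A" using False assms(3) by simp
    have "A = {a..<Suc ?m}"
      using down[OF _ m] assms(1,3) by (auto simp: less_Suc_eq_le)
    moreover have "a \<le> ?m" using m assms(1) by auto
    ultimately have "Suc ?m = a + card A"
      by (metis card_atLeastLessThan le_SucI le_add_diff_inverse)
    with \<open>A = {a..<Suc ?m}\<close> show ?thesis by metis
  qed simp
  then obtain c where c: "A = {a..<c}" "c = a + card A" by blast
  have "A \<inter> B = {}" using assms(2) by fastforce
  then have B: "B = {a..<b} - {a..<c}" using assms(1) c(1) by blast
  moreover have "{a..<b} - {a..<c} = {c..<b}" using c(2) by auto
  ultimately show "A = {a..<a + card A}" "B = {a + card A..<b}"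
    using c by metis+
qed

text \<open>The minimum \<open>k\<close> becomes the root. Avoidance forces the letters on either
  side of it into consecutive intervals, which are the blocks that \<open>word\<close> assigns to
  the subtrees, so induction applies to both sides.\<close>

lemma avoids_312_imp_word:
  assumes "avoids_312 xs" "distinct xs" "set xs = {k..<k + n}"
  shows "\<exists>t. size t = n \<and> xs = word k t"
  using assms
proof (induction n arbitrary: xs k rule: less_induct)
  case (less n)
  show ?case
  proof (cases "n = 0")
    case True
    with less.prems show ?thesis by (intro exI[of _ "\<langle>\<rangle>"]) auto
  next
    case False
    then have "k \<in> set xs" using less.prems by simp
    then obtain as bs where xs: "xs = as @ k # bs" by (meson split_list)
    note av = avoids_312_splitD[OF less.prems(1)[unfolded xs]]
    have dist: "distinct as" "distinct bs" "k \<notin> set as" "k \<notin> set bs" "set as \<inter> set bs = {}"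
      using less.prems(2) xs by auto
    have un: "set as \<union> set bs = {k + 1..<k + n}"
    proof -
      have "set as \<union> set bs = set xs - {k}" using xs dist by auto
      also have "\<dots> = {k..<k + n} - {k}" by (simp only: less.prems(3))
      also have "\<dots> = {k + 1..<k + n}" by auto
      finally show ?thesis .
    qed
    \<comment> \<open>Avoidance with \<open>k\<close> as the 1 rules out \<open>y < x\<close>;
      distinctness rules out equality.\<close>
    have lt: "\<forall>x\<in>set as. \<forall>y\<in>set bs. x < y"
    proof (intro ballI)
      fix x y assume xy: "x \<in> set as" "y \<in> set bs"
      then have "y \<in> {k + 1..<k + n}" using un by blast
      then have "k < y" by simp
      moreover have "x \<noteq> y" using xy dist by auto
      ultimately show "x < y" using av(3) xy by (meson linorder_neqE_nat)
    qed
    have len: "n = length as + length bs + 1"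
      using less.prems(2,3) xs distinct_card[of xs] by simp
    have A: "set as = {k + 1..<k + 1 + length as}" and B: "set bs = {k + 1 + length as..<k + n}"
      using split_interval[OF un lt] distinct_card[OF dist(1)] by simp_all
    obtain l where l: "size l = length as" "as = word (k + 1) l"
      using less.IH[of "length as", OF _ av(1) dist(1) A] len by auto
    have B': "set bs = {k + 1 + length as..<k + 1 + length as + length bs}"
      using B len by (simp add: ac_simps)
    obtain r where r: "size r = length bs" "bs = word (k + 1 + length as) r"
      using less.IH[of "length bs", OF _ av(2) dist(2) B'] len by auto
    show ?thesis
      using l r len xs by (intro exI[of _ "\<langle>l, (), r\<rangle>"]) auto
  qed
qed

section \<open>Mirroring\<close>

lemma starts_split:
  "starts R (xs @ k # ys) \<longleftrightarrow>
    (if xs = [] then ys \<noteq> [] \<and> R k (hd ys) else if length xs = 1 then R (hd xs) k else starts R xs)"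
  by (cases xs; cases "tl xs"; cases ys) auto

lemma ends_split:
  "ends R (xs @ k # ys) \<longleftrightarrow>
    (if ys = [] then xs \<noteq> [] \<and> R (last xs) k else if length ys = 1 then R k (hd ys) else ends R ys)"
proof (cases ys rule: rev_cases)
  case Nil
  then show ?thesis by (cases xs rule: rev_cases) auto
next
  case (snoc zs b)
  show ?thesis
  proof (cases zs rule: rev_cases)
    case inner: (snoc ws a)
    show ?thesis using snoc inner ends_simps(3)[of R "xs @ k # ws" a b] by simp
  qed (simp add: snoc)
qed

lemma hd_word_bounds: "t \<noteq> \<langle>\<rangle> \<Longrightarrow> k \<le> hd (word k t)"
  using hd_in_set[of "word k t"] by simp

lemma last_word_bounds: "t \<noteq> \<langle>\<rangle> \<Longrightarrow> k \<le> last (word k t) \<and> last (word k t) < k + size t"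
  using last_in_set[of "word k t"] by simp

text \<open>Of two inorder neighbours one is an ancestor of the other and has the smaller value.
  Mirroring reverses inorder and keeps ancestry, so an initial ascent becomes a final descent. The
  offsets are independent because mirroring changes the blocks given to subtrees.\<close>

lemma starts_less_word_mirror: "starts (<) (word k t) \<longleftrightarrow> ends (>) (word k' (mirror t))"
proof (induction t arbitrary: k k')
  case (Node l u r)
  then show ?case
    using hd_word_bounds[of r "k + 1 + size l"] last_word_bounds[of "mirror r" "k' + 1"]
      hd_word_bounds[of l "k + 1"] hd_word_bounds[of "mirror l" "k' + 1 + size r"]
    by (auto simp: starts_split ends_split)
qed simp

lemma starts_greater_word_mirror: "starts (>) (word k t) \<longleftrightarrow> ends (<) (word k' (mirror t))"
proof (induction t arbitrary: k k')
  case (Node l u r)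
  then show ?case
    using hd_word_bounds[of r "k + 1 + size l"] last_word_bounds[of "mirror r" "k' + 1"]
      hd_word_bounds[of l "k + 1"] hd_word_bounds[of "mirror l" "k' + 1 + size r"]
    by (auto simp: starts_split ends_split)
qed simp

text \<open>Together with the next three facts this simplifies a pattern with one entry fixed to the
  root value: all letters of the subwords exceed it, so the pattern reduces to a comparison of two
  letters or becomes impossible.\<close>

lemma starts_cong: "(\<And>a b. a \<in> set xs \<Longrightarrow> b \<in> set xs \<Longrightarrow> R a b = S a b) \<Longrightarrow> starts R xs = starts S xs"
  by (auto simp: starts_def)

lemma ends_cong: "(\<And>a b. a \<in> set xs \<Longrightarrow> b \<in> set xs \<Longrightarrow> R a b = S a b) \<Longrightarrow> ends R xs = ends S xs"
  by (auto simp: ends_def)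

lemma not_starts: "(\<And>a b. a \<in> set xs \<Longrightarrow> b \<in> set xs \<Longrightarrow> \<not> R a b) \<Longrightarrow> \<not> starts R xs"
  by (auto simp: starts_def)

lemma not_ends: "(\<And>a b. a \<in> set xs \<Longrightarrow> b \<in> set xs \<Longrightarrow> \<not> R a b) \<Longrightarrow> \<not> ends R xs"
  by (auto simp: ends_def)

section \<open>Recursions for the pattern counts at the root\<close>

abbreviation (input) "pat_321 \<equiv> \<lambda>a b c::nat. c < b \<and> b < a"
abbreviation (input) "pat_123 \<equiv> \<lambda>a b c::nat. a < b \<and> b < c"
abbreviation (input) "pat_132 \<equiv> \<lambda>a b c::nat. a < c \<and> c < b"
abbreviation (input) "pat_231 \<equiv> \<lambda>a b c::nat. c < a \<and> a < b"
abbreviation (input) "pat_213 \<equiv> \<lambda>a b c::nat. b < a \<and> a < c"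

text \<open>The root value is the minimum and can only play the 1. In 321 and 231 the 1 comes last,
  so the final two letters of the left word decide; in 123 and 132 it comes first, so the initial
  two letters of the right word decide.\<close>

lemma triples_word_321:
  "triples pat_321 (word k \<langle>l, u, r\<rangle>) = triples pat_321 (word (k + 1) l)
     + triples pat_321 (word (k + 1 + size l) r) + of_bool (ends (>) (word (k + 1) l))"
proof -
  let ?A = "word (k + 1) l" and ?B = "word (k + 1 + size l) r"
  have "ends (\<lambda>a b. pat_321 a b k) ?A = ends (>) ?A" by (rule ends_cong) auto
  moreover have "\<not> starts (pat_321 k) ?B" by (rule not_starts) auto
  ultimately show ?thesis
    using hd_word_bounds[of r "k + 1 + size l"] by (auto simp: triples_split)
qed

lemma triples_word_123:
  "triples pat_123 (word k \<langle>l, u, r\<rangle>) = triples pat_123 (word (k + 1) l)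
     + triples pat_123 (word (k + 1 + size l) r) + of_bool (starts (<) (word (k + 1 + size l) r))"
proof -
  let ?A = "word (k + 1) l" and ?B = "word (k + 1 + size l) r"
  have "starts (pat_123 k) ?B = starts (<) ?B" by (rule starts_cong) auto
  moreover have "\<not> ends (\<lambda>a b. pat_123 a b k) ?A" by (rule not_ends) auto
  ultimately show ?thesis
    using last_word_bounds[of l "k + 1"] by (auto simp: triples_split)
qed

lemma triples_word_132:
  "triples pat_132 (word k \<langle>l, u, r\<rangle>) = triples pat_132 (word (k + 1) l)
     + triples pat_132 (word (k + 1 + size l) r) + of_bool (starts (>) (word (k + 1 + size l) r))"
proof -
  let ?A = "word (k + 1) l" and ?B = "word (k + 1 + size l) r"
  have "starts (pat_132 k) ?B = starts (>) ?B" by (rule starts_cong) auto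
  moreover have "\<not> ends (\<lambda>a b. pat_132 a b k) ?A" by (rule not_ends) auto
  ultimately show ?thesis
    using hd_word_bounds[of r "k + 1 + size l"] by (auto simp: triples_split)
qed

lemma triples_word_231:
  "triples pat_231 (word k \<langle>l, u, r\<rangle>) = triples pat_231 (word (k + 1) l)
     + triples pat_231 (word (k + 1 + size l) r) + of_bool (ends (<) (word (k + 1) l))"
proof -
  let ?A = "word (k + 1) l" and ?B = "word (k + 1 + size l) r"
  have "ends (\<lambda>a b. pat_231 a b k) ?A = ends (<) ?A" by (rule ends_cong) auto
  moreover have "\<not> starts (pat_231 k) ?B" by (rule not_starts) auto
  ultimately show ?thesis
    using last_word_bounds[of l "k + 1"] by (auto simp: triples_split)
qed

text \<open>Here the 1 is in the middle, and left values lie below right values anyway, so only the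
  presence of both neighbours matters.\<close>

lemma triples_word_213:
  "triples pat_213 (word k \<langle>l, u, r\<rangle>) = triples pat_213 (word (k + 1) l)
     + triples pat_213 (word (k + 1 + size l) r) + of_bool (l \<noteq> \<langle>\<rangle> \<and> r \<noteq> \<langle>\<rangle>)"
proof -
  let ?A = "word (k + 1) l" and ?B = "word (k + 1 + size l) r"
  have "\<not> starts (pat_213 k) ?B" by (rule not_starts) auto
  moreover have "\<not> ends (\<lambda>a b. pat_213 a b k) ?A" by (rule not_ends) auto
  ultimately show ?thesis
    using last_word_bounds[of l "k + 1"] hd_word_bounds[of r "k + 1 + size l"]
    by (cases "l = \<langle>\<rangle>"; cases "r = \<langle>\<rangle>") (simp_all add: triples_split triples_Cons)
qed

section \<open>Pattern counts under mirroring\<close>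

lemma triples_123_mirror: "triples pat_123 (word k' (mirror t)) = triples pat_321 (word k t)"
proof (induction t arbitrary: k k')
  case (Node l u r)
  \<comment> \<open>The exchange of starts and ends is applied to \<open>mirror l\<close>, whose
    mirror is \<open>l\<close> again.\<close>
  have "starts (<) (word (k' + 1 + size r) (mirror l)) = ends (>) (word (k + 1) l)"
    using starts_less_word_mirror[of _ "mirror l"] by simp
  then show ?case
    using Node.IH(1)[where k = "k + 1" and k' = "k' + 1 + size r"]
      Node.IH(2)[where k = "k + 1 + size l" and k' = "k' + 1"]
    by (simp only: mirror.simps triples_word_123 triples_word_321 size_mirror)
qed simp

lemma triples_231_mirror: "triples pat_231 (word k' (mirror t)) = triples pat_132 (word k t)"
proof (induction t arbitrary: k k')
  case (Node l u r)
  have "ends (<) (word (k' + 1) (mirror r)) = starts (>) (word (k + 1 + size l) r)"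
    using starts_greater_word_mirror by blast
  then show ?case
    using Node.IH(1)[where k = "k + 1" and k' = "k' + 1 + size r"]
      Node.IH(2)[where k = "k + 1 + size l" and k' = "k' + 1"]
    by (simp only: mirror.simps triples_word_231 triples_word_132 size_mirror)
qed simp

lemma triples_132_mirror: "triples pat_132 (word k' (mirror t)) = triples pat_231 (word k t)"
  using triples_231_mirror[of k "mirror t" k'] by simp

lemma triples_213_mirror: "triples pat_213 (word k' (mirror t)) = triples pat_213 (word k t)"
proof (induction t arbitrary: k k')
  case (Node l u r)
  show ?case
    using Node.IH(1)[where k = "k + 1" and k' = "k' + 1 + size r"]
      Node.IH(2)[where k = "k + 1 + size l" and k' = "k' + 1"]
    by (simp only: mirror.simps triples_word_213 size_mirror) auto
qed simp

lemma bij_betw_mirror: "bij_betw mirror {t :: 'a tree. size t = n} {t. size t = n}"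
  by (rule bij_betw_byWitness[where f' = mirror]) auto

section \<open>Permutations in one-line notation\<close>

definition one_line :: "nat \<Rightarrow> (nat \<Rightarrow> nat) \<Rightarrow> nat list" where
  "one_line n \<sigma> = map (\<lambda>i. \<sigma> (i + 1)) [0..<n]"

lemma length_one_line [simp]: "length (one_line n \<sigma>) = n"
  by (simp add: one_line_def)

lemma nth_one_line [simp]: "i < n \<Longrightarrow> one_line n \<sigma> ! i = \<sigma> (i + 1)"
  by (simp add: one_line_def)

lemma avoids_312_one_line_iff:
  "avoids_312 (one_line n \<sigma>) \<longleftrightarrow>
     \<not> (\<exists>i j l. 1 \<le> i \<and> i < j \<and> j < l \<and> l \<le> n \<and> \<sigma> j < \<sigma> l \<and> \<sigma> l < \<sigma> i)"
proof -
  have "(\<exists>i j l. i < j \<and> j < l \<and> l < n \<and> \<sigma> (j + 1) < \<sigma> (l + 1) \<and> \<sigma> (l + 1) < \<sigma> (i + 1))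
    \<longleftrightarrow> (\<exists>i j l. 1 \<le> i \<and> i < j \<and> j < l \<and> l \<le> n \<and> \<sigma> j < \<sigma> l \<and> \<sigma> l < \<sigma> i)" (is "?L \<longleftrightarrow> ?R")
  proof
    assume ?L
    then obtain i j l where "i < j" "j < l" "l < n" "\<sigma> (j + 1) < \<sigma> (l + 1)" "\<sigma> (l + 1) < \<sigma> (i + 1)"
      by blast
    then show ?R by (intro exI[of _ "i + 1"] exI[of _ "j + 1"] exI[of _ "l + 1"]) auto
  next
    assume ?R
    then obtain i j l where "1 \<le> i" "i < j" "j < l" "l \<le> n" "\<sigma> j < \<sigma> l" "\<sigma> l < \<sigma> i"
      by blast
    then show ?L by (intro exI[of _ "i - 1"] exI[of _ "j - 1"] exI[of _ "l - 1"]) auto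
  qed
  moreover have "avoids_312 (one_line n \<sigma>) \<longleftrightarrow>
     \<not> (\<exists>i j l. i < j \<and> j < l \<and> l < n \<and> \<sigma> (j + 1) < \<sigma> (l + 1) \<and> \<sigma> (l + 1) < \<sigma> (i + 1))"
    unfolding avoids_312_iff_nth by (auto cong: conj_cong)
  ultimately show ?thesis by simp
qed

lemma set_one_line: "set (one_line n \<sigma>) = \<sigma> ` {1..n}"
proof -
  have "{1..n} = Suc ` {0..<n}" by (auto simp: image_iff Suc_le_eq gr0_conv_Suc)
  then show ?thesis by (simp only: one_line_def set_map image_image set_upt) simp
qed

text \<open>A permutation of \<open>{1..n}\<close> is the identity elsewhere, so its one-line word
  determines it; the words obtained are the tree words with values from 1.\<close>

lemma bij_betw_one_line: "bij_betw (one_line n) (S_312 n) (word 1 ` {t. size t = n})"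
  unfolding bij_betw_def
proof (intro conjI)
  show "inj_on (one_line n) (S_312 n)"
  proof (rule inj_onI, rule ext)
    fix \<sigma> \<rho> i assume *: "\<sigma> \<in> S_312 n" "\<rho> \<in> S_312 n" "one_line n \<sigma> = one_line n \<rho>"
    show "\<sigma> i = \<rho> i"
    proof (cases "i \<in> {1..n}")
      case True
      then show ?thesis
        using arg_cong[OF *(3), of "\<lambda>xs. xs ! (i - 1)"] nth_one_line[of "i - 1" n] by auto
    next
      case False
      then show ?thesis using *(1,2) by (auto simp: S_312_def permutes_def)
    qed
  qed
  show "one_line n ` S_312 n = word 1 ` {t. size t = n}"
  proof (intro subset_antisym image_subsetI)
    fix \<sigma> assume "\<sigma> \<in> S_312 n"
    then have p: "\<sigma> permutes {1..n}" and av: "avoids_312 (one_line n \<sigma>)"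
      unfolding S_312_def avoids_312_one_line_iff by blast+
    have set: "set (one_line n \<sigma>) = {1..n}"
      using p by (simp add: set_one_line permutes_image)
    then have "distinct (one_line n \<sigma>)" by (intro card_distinct) simp
    then show "one_line n \<sigma> \<in> word 1 ` {t. size t = n}"
      using avoids_312_imp_word[OF av, of 1 n] set by (auto simp: atLeastLessThanSuc_atLeastAtMost)
  next
    fix t :: "unit tree" assume "t \<in> {t. size t = n}"
    then have t: "size t = n" by simp
    \<comment> \<open>The word is read with positions shifted by one and extended by the identity,
      as \<open>permutes\<close> requires.\<close>
    define \<sigma> where "\<sigma> i = (if i \<in> {1..n} then word 1 t ! (i - 1) else i)" for i
    have ol: "one_line n \<sigma> = word 1 t"
      by (rule nth_equalityI) (auto simp: t \<sigma>_def)
    have im: "\<sigma> ` {1..n} = {1..n}"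
      using ol set_one_line[of n \<sigma>] t by (simp add: atLeastLessThanSuc_atLeastAtMost)
    \<comment> \<open>A map of a finite set onto itself is injective.\<close>
    then have "bij_betw \<sigma> {1..n} {1..n}"
      by (simp add: bij_betw_def eq_card_imp_inj_on)
    then have "\<sigma> permutes {1..n}"
      by (rule bij_imp_permutes) (auto simp: \<sigma>_def)
    moreover have "avoids_312 (one_line n \<sigma>)" by (simp add: ol avoids_312_word)
    ultimately have "\<sigma> \<in> S_312 n" by (simp only: S_312_def avoids_312_one_line_iff mem_Collect_eq simp_thms)
    then show "word 1 t \<in> one_line n ` S_312 n" using ol by (metis image_eqI)
  qed
qed

lemma sum_S_312_eq_sum_trees:
  "(\<Sum>\<sigma>\<in>S_312 n. f (one_line n \<sigma>)) = (\<Sum>t | size t = n. f (word 1 t))"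
proof -
  have "(\<Sum>\<sigma>\<in>S_312 n. f (one_line n \<sigma>)) = (\<Sum>xs\<in>word 1 ` {t. size t = n}. f xs)"
    by (rule sum.reindex_bij_betw[OF bij_betw_one_line])
  also have "\<dots> = (\<Sum>t | size t = n. f (word 1 t))"
    by (subst sum.reindex) (auto intro: inj_onI word_inject)
  finally show ?thesis .
qed

section \<open>Pattern occurrences as windows of the one-line word\<close>

lemma occ_eq_triples:
  assumes "\<And>a b c. P a b c \<longleftrightarrow> (\<forall>i<3. \<forall>j<3. [a, b, c] ! i < [a, b, c] ! j \<longleftrightarrow> \<tau> ! i < \<tau> ! j)"
  shows "occ \<tau> n \<sigma> = triples P (one_line n \<sigma>)"
proof -
  let ?I = "{i. i + 2 < n \<and> P (\<sigma> (i + 1)) (\<sigma> (i + 2)) (\<sigma> (i + 3))}"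
  let ?J = "{i. 1 \<le> i \<and> i + 2 \<le> n \<and> (\<forall>a<3. \<forall>b<3. \<sigma> (i + a) < \<sigma> (i + b) \<longleftrightarrow> \<tau> ! a < \<tau> ! b)}"
  have nth: "[\<sigma> i, \<sigma> (i + 1), \<sigma> (i + 2)] ! a = \<sigma> (i + a)" if "a < 3" for i a
    using that by (auto simp: numeral_3_eq_3 less_Suc_eq)
  have P: "P (\<sigma> i) (\<sigma> (i + 1)) (\<sigma> (i + 2)) \<longleftrightarrow>
      (\<forall>a<3. \<forall>b<3. \<sigma> (i + a) < \<sigma> (i + b) \<longleftrightarrow> \<tau> ! a < \<tau> ! b)" for i
    unfolding assms using nth by auto
  \<comment> \<open>Occurrences are indexed from 1, list windows from 0.\<close>
  have "?J = Suc ` ?I"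
  proof (rule set_eqI)
    fix i show "i \<in> ?J \<longleftrightarrow> i \<in> Suc ` ?I"
      unfolding P[symmetric] by (cases i) (auto simp: image_iff eval_nat_numeral)
  qed
  then have "occ \<tau> n \<sigma> = card ?I"
    unfolding occ_def by (simp add: card_image)
  also have "\<dots> = triples P (one_line n \<sigma>)"
    unfolding triples_conv_card by (rule arg_cong[of _ _ card]) (auto simp: eval_nat_numeral)
  finally show ?thesis .
qed

lemma all_less_3: "(\<forall>i<3. Q i) \<longleftrightarrow> Q 0 \<and> Q 1 \<and> Q (2::nat)"
  by (auto simp: eval_nat_numeral less_Suc_eq)

lemma occ_conv_triples:
  "occ [3,2,1] n \<sigma> = triples pat_321 (one_line n \<sigma>)"
  "occ [1,2,3] n \<sigma> = triples pat_123 (one_line n \<sigma>)"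
  "occ [1,3,2] n \<sigma> = triples pat_132 (one_line n \<sigma>)"
  "occ [2,3,1] n \<sigma> = triples pat_231 (one_line n \<sigma>)"
  "occ [2,1,3] n \<sigma> = triples pat_213 (one_line n \<sigma>)"
  by (rule occ_eq_triples; unfold all_less_3; auto)+

text \<open>The variables range over any commutative semiring; taking indeterminates of a polynomial
  semiring gives the identities of generating functions.\<close>

theorem theorem15:
  fixes n :: nat and x y z :: "'a::comm_semiring_1"
  shows "(\<Sum>\<sigma>\<in>S_312 n. x ^ occ [3,2,1] n \<sigma> * y ^ occ [1,3,2] n \<sigma> * z ^ occ [2,1,3] n \<sigma>)
       = (\<Sum>\<sigma>\<in>S_312 n. x ^ occ [1,2,3] n \<sigma> * y ^ occ [2,3,1] n \<sigma> * z ^ occ [2,1,3] n \<sigma>)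
     \<and> (\<Sum>\<sigma>\<in>S_312 n. x ^ occ [3,2,1] n \<sigma> * y ^ occ [2,3,1] n \<sigma> * z ^ occ [2,1,3] n \<sigma>)
       = (\<Sum>\<sigma>\<in>S_312 n. x ^ occ [1,2,3] n \<sigma> * y ^ occ [1,3,2] n \<sigma> * z ^ occ [2,1,3] n \<sigma>)"
proof -
  define F where "F P Q t = x ^ triples P (word 1 t) * y ^ triples Q (word 1 t)
    * z ^ triples pat_213 (word 1 t)" for P Q t
  have trees: "(\<Sum>\<sigma>\<in>S_312 n. x ^ triples P (one_line n \<sigma>) * y ^ triples Q (one_line n \<sigma>)
      * z ^ triples pat_213 (one_line n \<sigma>)) = (\<Sum>t | size t = n. F P Q t)" for P Q
    unfolding F_def by (rule sum_S_312_eq_sum_trees)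
  \<comment> \<open>Mirroring permutes the trees of size \<open>n\<close>, so it may be inserted
    into the right-hand sum of either identity; the summands then agree tree by tree.\<close>
  have mirror: "(\<Sum>t | size t = n. F P Q (mirror t)) = (\<Sum>t | size t = n. F P Q t)" for P Q
    by (rule sum.reindex_bij_betw[OF bij_betw_mirror])
  have "F pat_123 pat_231 (mirror t) = F pat_321 pat_132 t"
    "F pat_123 pat_132 (mirror t) = F pat_321 pat_231 t" for t
    unfolding F_def
    by (simp_all only: triples_123_mirror[of 1 t 1] triples_231_mirror[of 1 t 1]
        triples_132_mirror[of 1 t 1] triples_213_mirror[of 1 t 1])
  then show ?thesis
    unfolding occ_conv_triples trees
    using mirror[of pat_123 pat_231] mirror[of pat_123 pat_132] by simp
qed

end
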